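(* There is an absolute constant $\alpha>0$ (one can choose $\alpha=0.46$) such that the following holds. Let $A=(a_{ij})$ be an $m\times n$ integer matrix and let $$X=\Bigl\{x\in\{0,1\}^n,\ x=(\xi_1,\ldots,\xi_n):\ \sum_{j=1}^n a_{ij}\xi_j=0\ \text{ for } i=1,\ldots,m\Bigr\}.$$ Suppose that the number of non-zero entries in every row of $A$ does not exceed $r$ for some $r\geq 2$ and that the number of non-zero entries in every column of $A$ does not exceed $c$ for some $c\geq 1$. If $w_1,\ldots,w_n\in\mathbb{C}$ satisfy $$|w_j|\leq\frac{\alpha}{r\sqrt{c}}\quad\text{for } j=1,\ldots,n,$$ then $w(X)\neq 0$.
   Context: For complex numbers $w_1,\ldots,w_n$ (weights) and a set $X\subset\{0,1\}^n$, the weight of $X$ is $$w(X)=\sum_{x\in X,\ x=(\xi_1,\ldots,\xi_n)} w_1^{\xi_1}\cdots w_n^{\xi_n},$$ with the convention $0^0=1$. *)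

theory Defs
  imports Complex_Main "Jordan_Normal_Form.Matrix"
begin

definition cube :: "nat \<Rightarrow> nat vec set" where
  "cube n = {x \<in> carrier_vec n. \<forall>j<n. x $ j \<in> {0, 1}}"

(* The convention 0^0 = 1 is the one of the library power function. *)
definition weight :: "complex vec \<Rightarrow> nat vec set \<Rightarrow> complex" where
  "weight w X = (\<Sum>x\<in>X. \<Prod>j<dim_vec w. (w $ j) ^ (x $ j))"

definition solutions :: "int mat \<Rightarrow> nat vec set" where
  "solutions A = {x \<in> cube (dim_col A).
     \<forall>i<dim_row A. (\<Sum>j<dim_col A. A $$ (i, j) * int (x $ j)) = 0}"

(* The constant alpha is absolute: it is fixed before m, n, A, r, c and w. *)
definition nonvanishing_constant :: "real \<Rightarrow> bool" where
  "nonvanishing_constant \<alpha> \<longleftrightarrow>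
     (\<forall>(m::nat) (n::nat) (A::int mat) (r::nat) (c::nat) (w::complex vec).
        A \<in> carrier_mat m n \<longrightarrow>
        r \<ge> 2 \<longrightarrow>
        c \<ge> 1 \<longrightarrow>
        (\<forall>i<m. card {j. j < n \<and> A $$ (i, j) \<noteq> 0} \<le> r) \<longrightarrow>
        (\<forall>j<n. card {i. i < m \<and> A $$ (i, j) \<noteq> 0} \<le> c) \<longrightarrow>
        w \<in> carrier_vec n \<longrightarrow>
        (\<forall>j<n. cmod (w $ j) \<le> \<alpha> / (real r * sqrt (real c))) \<longrightarrow>
        weight w (solutions A) \<noteq> 0)"

end

theory Submission
  imports Defs "HOL-Analysis.Analysis"
begin

text \<open>
  Write \<open>e(t) = exp (2 \<pi> i t / N)\<close> for an integer \<open>N\<close> larger than every absolute row sum of the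
  matrix. Expanding the product and using orthogonality of the characters of \<open>\<int>/N\<close>, the weight of
  the solution set is the average, over \<open>x\<close> in \<open>{0, ..., N - 1}\<^sup>m\<close>, of
  \<open>\<Prod>\<^sub>j (1 + w\<^sub>j e(\<Sum>\<^sub>i a\<^sub>i\<^sub>j x\<^sub>i))\<close>
  (\<open>weight_solutions_as_average\<close>). The weights are smaller than \<open>1\<close> in absolute value, so each factor is
  \<open>exp (\<phi>\<^sub>j x)\<close> with \<open>\<phi>\<^sub>j\<close> the principal logarithm. Thus the weight is a multiple of a partition
  function \<open>\<Sum>\<^sub>x exp (\<Sum>\<^sub>j \<phi>\<^sub>j x)\<close>, in which each \<open>\<phi>\<^sub>j\<close> is bounded by some \<open>B\<close> and depends on at most \<open>c\<close>
  coordinates, and each coordinate influences at most \<open>r\<close> of the \<open>\<phi>\<^sub>j\<close>.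

  Such a sum is nonzero when \<open>B\<close> is of order \<open>1 / (r \<surd>c)\<close>. The proof is an induction on the number
  of free coordinates of a face of the grid. Next to nonvanishing, the induction carries the statement
  that moving one fixed coordinate turns the argument of the sum over the face by at most \<open>\<theta>\<close>
  (\<open>tame\<close>). This feeds two estimates.

  First, complex numbers whose pairwise angles are at most \<open>\<theta> < 2 \<pi> / 3\<close> lie in a common sector of
  opening \<open>\<theta>\<close>, so that the modulus of their sum is at least \<open>cos (\<theta> / 2)\<close> times the sum of their
  moduli (\<open>sector_sum_lower_bound\<close>). Splitting a face along one coordinate gives nonvanishing; splitting
  it along the at most \<open>c\<close> coordinates on which a function \<open>\<psi>\<close> depends gives
  \<open>\<bar>\<Sum> \<psi> exp \<phi>\<bar> \<le> sup \<bar>\<psi>\<bar> / cos (\<theta> / 2)\<^sup>c \<bar>\<Sum> exp \<phi>\<bar>\<close> (\<open>local_observable_bound\<close>).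

  Secondly, moving a fixed coordinate only replaces at most \<open>r\<close> of the functions \<open>\<phi>\<^sub>j\<close> by others of the
  same kind. Interpolating linearly between the two families stays within the class, and by
  \<open>local_observable_bound\<close> the logarithmic derivative along the path is at most
  \<open>2 r B / cos (\<theta> / 2)\<^sup>c\<close>. If this is at most \<open>\<theta>\<close>, then so is the angle, and the induction closes
  (\<open>Z_update_ratio\<close>).

  The choice \<open>\<theta> = 3 / (2 \<surd>c)\<close> makes \<open>cos (\<theta> / 2)\<^sup>c\<close> at least \<open>1 - 9 / 32 = 23 / 32\<close> by Bernoulli's
  inequality, so the condition becomes \<open>2 r B \<surd>c \<le> 69 / 64 = 1.078...\<close>. For \<open>\<alpha> = 0.46\<close> all weights are
  at most \<open>0.23\<close>, where the logarithm costs a factor \<open>1.15\<close>, and \<open>2 * 1.15 * 0.46 = 1.058\<close>.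
\<close>

section \<open>Sums in a sector and paths of nonzero numbers\<close>

text \<open>Fixing arguments relative to one of the numbers, two of them differ by at most \<open>\<theta>\<close> modulo \<open>2 \<pi>\<close>, and
by at most \<open>2 \<theta>\<close> because both are close to the reference. Since \<open>3 \<theta> < 2 \<pi>\<close> the ambiguity modulo
\<open>2 \<pi>\<close> disappears, so all arguments lie in one interval of length \<open>\<theta>\<close>. Projecting to the direction of
its midpoint loses at most the factor \<open>cos (\<theta> / 2)\<close>.\<close>

lemma sector_sum_lower_bound:
  fixes v :: "'a \<Rightarrow> complex"
  assumes fin: "finite D" and \<theta>: "3 * \<theta> < 2 * pi"
    and nz: "\<And>s. s \<in> D \<Longrightarrow> v s \<noteq> 0"
    and close: "\<And>s t. s \<in> D \<Longrightarrow> t \<in> D \<Longrightarrow> \<exists>z. \<bar>Im z\<bar> \<le> \<theta> \<and> v s = v t * exp z"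
  shows "cos (\<theta> / 2) * (\<Sum>s\<in>D. cmod (v s)) \<le> cmod (\<Sum>s\<in>D. v s)"
proof (cases "D = {}")
  case False
  then obtain t0 where t0: "t0 \<in> D" by blast
  have "\<forall>s\<in>D. \<exists>z. \<bar>Im z\<bar> \<le> \<theta> \<and> v s = v t0 * exp z"
    using close t0 by blast
  then obtain z where z: "\<And>s. s \<in> D \<Longrightarrow> \<bar>Im (z s)\<bar> \<le> \<theta> \<and> v s = v t0 * exp (z s)"
    by metis
  have diff: "Im (z s) - Im (z t) \<le> \<theta>" if s: "s \<in> D" and t: "t \<in> D" for s t
  proof -
    obtain \<zeta> where \<zeta>: "\<bar>Im \<zeta>\<bar> \<le> \<theta>" "v s = v t * exp \<zeta>" using close s t by blast
    have "exp (z s) = exp (z t + \<zeta>)"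
      using z[OF s] z[OF t] \<zeta>(2) nz[OF t0] by (simp add: exp_add)
    then obtain k :: int where "z s = z t + \<zeta> + of_int (2 * k) * pi * \<i>"
      unfolding exp_eq by blast
    then have im: "Im (z s) = Im (z t) + Im \<zeta> + 2 * k * pi" by simp
    have "\<bar>2 * k * pi\<bar> < 2 * pi"
      using im z[OF s] z[OF t] \<zeta>(1) \<theta> by linarith
    then have "\<bar>real_of_int k\<bar> < 1" by (simp add: abs_mult)
    then have "k = 0" by linarith
    then show ?thesis using im \<zeta>(1) by simp
  qed
  define lo where "lo = Min ((\<lambda>s. Im (z s)) ` D)"
  define \<mu> where "\<mu> = lo + \<theta> / 2"
  have "lo \<in> (\<lambda>s. Im (z s)) ` D" unfolding lo_def using fin False by (intro Min_in) auto
  then obtain s0 where s0: "s0 \<in> D" "lo = Im (z s0)" by blast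
  have near: "\<bar>Im (z s) - \<mu>\<bar> \<le> \<theta> / 2" if "s \<in> D" for s
  proof -
    have "lo \<le> Im (z s)" unfolding lo_def using fin that by simp
    moreover have "Im (z s) \<le> lo + \<theta>" using diff[OF that s0(1)] s0(2) by simp
    ultimately show ?thesis unfolding \<mu>_def by (simp add: abs_le_iff field_simps)
  qed
  \<comment> \<open>Multiplication by \<open>u\<close> rotates the midpoint direction onto the positive real axis.\<close>
  define u where "u = exp (- \<i> * \<mu>) * (cnj (v t0) / cmod (v t0))"
  have nu: "cmod u = 1" unfolding u_def using nz[OF t0] by (simp add: norm_mult norm_divide)
  have re: "Re (u * v s) = cmod (v s) * cos (Im (z s) - \<mu>)" if s: "s \<in> D" for s
  proof -
    have "u * v s = (v t0 * cnj (v t0) / cmod (v t0)) * exp (z s - \<i> * \<mu>)"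
      unfolding u_def using z[OF s] by (simp add: exp_diff exp_minus field_simps)
    also have "v t0 * cnj (v t0) / cmod (v t0) = of_real (cmod (v t0))"
      using nz[OF t0] by (simp add: power2_eq_square flip: complex_norm_square)
    finally have "Re (u * v s) = cmod (v t0) * Re (exp (z s - \<i> * \<mu>))" by simp
    moreover have "cmod (v s) = cmod (v t0) * exp (Re (z s))"
      using z[OF s] by (simp add: norm_mult)
    ultimately show ?thesis by (simp add: Re_exp)
  qed
  have "cos (\<theta> / 2) * (\<Sum>s\<in>D. cmod (v s)) = (\<Sum>s\<in>D. cmod (v s) * cos (\<theta> / 2))"
    by (simp add: sum_distrib_right mult.commute)
  also have "\<dots> \<le> (\<Sum>s\<in>D. cmod (v s) * cos (Im (z s) - \<mu>))"
  proof (intro sum_mono mult_left_mono)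
    fix s assume s: "s \<in> D"
    have "cos (\<theta> / 2) \<le> cos \<bar>Im (z s) - \<mu>\<bar>"
      using near[OF s] \<theta> pi_gt_zero by (intro cos_monotone_0_pi_le) (simp, simp, linarith)
    then show "cos (\<theta> / 2) \<le> cos (Im (z s) - \<mu>)" by simp
  qed auto
  also have "\<dots> = Re (u * (\<Sum>s\<in>D. v s))"
    using re by (simp add: sum_distrib_left del: times_complex.sel)
  also have "\<dots> \<le> cmod (u * (\<Sum>s\<in>D. v s))" by (rule complex_Re_le_cmod)
  finally show ?thesis by (simp add: norm_mult nu)
qed simp

text \<open>With \<open>G\<close> an antiderivative of \<open>F' / F\<close> the function \<open>F exp (- G)\<close> is constant, and \<open>G\<close> moves by at
most \<open>K\<close> over the unit interval.\<close>

lemma endpoint_ratio_of_log_derivative_bound: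
  fixes F F' :: "real \<Rightarrow> complex"
  assumes deriv: "\<And>t. t \<in> {0..1} \<Longrightarrow> (F has_vector_derivative F' t) (at t within {0..1})"
    and cont: "continuous_on {0..1} F'"
    and nz: "\<And>t. t \<in> {0..1} \<Longrightarrow> F t \<noteq> 0"
    and bound: "\<And>t. t \<in> {0..1} \<Longrightarrow> cmod (F' t) \<le> K * cmod (F t)"
  shows "\<exists>z. cmod z \<le> K \<and> F 1 = F 0 * exp z"
proof -
  have contF: "continuous_on {0..1} F"
    using deriv has_vector_derivative_continuous continuous_on_eq_continuous_within by blast
  have "continuous_on {0..1} (\<lambda>t. F' t / F t)"
    using cont contF nz by (intro continuous_intros) auto
  then obtain G where G: "\<And>t. t \<in> {0..1} \<Longrightarrow>
      (G has_vector_derivative F' t / F t) (at t within {0..1})"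
    by (rule antiderivative_continuous) blast
  have const: "((\<lambda>t. F t * exp (- G t)) has_vector_derivative 0) (at t within {0..1})"
    if t: "t \<in> {0..1}" for t
  proof -
    have "((\<lambda>t. exp (- G t)) has_vector_derivative (- (F' t / F t)) * exp (- G t)) (at t within {0..1})"
      using field_vector_diff_chain_within[OF has_vector_derivative_minus[OF G[OF t]], of exp "exp (- G t)"]
      by (simp add: o_def has_field_derivative_at_within DERIV_exp)
    from has_vector_derivative_mult[OF deriv[OF t] this]
    show ?thesis using nz[OF t] by simp
  qed
  have "F 1 * exp (- G 1) = F 0 * exp (- G 0)"
  proof (rule has_vector_derivative_zero_constant[of "{0..1::real}" "\<lambda>t. F t * exp (- G t)"])
    fix C assume "\<And>t. t \<in> {0..1} \<Longrightarrow> F t * exp (- G t) = C"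
    from this[of 0] this[of 1] show ?thesis by simp
  qed (simp, rule const)
  then have "F 1 * exp (- G 1) * exp (G 1) = F 0 * (exp (- G 0) * exp (G 1))" by (simp only: mult.assoc)
  moreover have "F 1 * exp (- G 1) * exp (G 1) = F 1"
    by (simp add: mult.assoc flip: exp_add)
  moreover have "exp (- G 0) * exp (G 1) = exp (G 1 - G 0)"
    by (simp flip: exp_add)
  ultimately have "F 1 = F 0 * exp (G 1 - G 0)" by (simp only:)
  moreover have "cmod (G 1 - G 0) \<le> K"
  proof -
    have "norm (G 1 - G 0) \<le> K * norm (1 - 0 :: real)"
    proof (rule differentiable_bound[where S = "{0..1}" and f' = "\<lambda>t h. h *\<^sub>R (F' t / F t)"])
      fix t :: real assume t: "t \<in> {0..1}"
      show "(G has_derivative (\<lambda>h. h *\<^sub>R (F' t / F t))) (at t within {0..1})"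
        using G[OF t] by (simp add: has_vector_derivative_def)
      show "onorm (\<lambda>h. h *\<^sub>R (F' t / F t)) \<le> K"
      proof (rule onorm_le)
        fix h :: real
        have "cmod (F' t / F t) \<le> K"
          using bound[OF t] nz[OF t] by (simp add: norm_divide divide_le_eq)
        then have "\<bar>h\<bar> * cmod (F' t / F t) \<le> \<bar>h\<bar> * K" by (rule mult_left_mono) simp
        then show "norm (h *\<^sub>R (F' t / F t)) \<le> K * norm h"
          by (simp only: norm_scaleR real_norm_def mult.commute)
      qed
    qed simp_all
    then show ?thesis by simp
  qed
  ultimately show ?thesis by blast
qed

section \<open>Faces of a grid\<close>

text \<open>Faces are sets of total functions whose values outside the free coordinates \<open>J\<close> agree with \<open>y\<close>. In this
way a change of a fixed coordinate is a function update of the base point \<open>y\<close>.\<close>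

definition face :: "'a set \<Rightarrow> 'i set \<Rightarrow> ('i \<Rightarrow> 'a) \<Rightarrow> ('i \<Rightarrow> 'a) set" where
  "face D J y = {x. (\<forall>i\<in>J. x i \<in> D) \<and> (\<forall>i. i \<notin> J \<longrightarrow> x i = y i)}"

lemma face_empty [simp]: "face D {} y = {y}"
  by (auto simp: face_def)

lemma face_insert: "i \<notin> J \<Longrightarrow> face D (insert i J) y = (\<Union>a\<in>D. face D J (y(i := a)))"
  by (auto simp: face_def)

lemma finite_face: "finite D \<Longrightarrow> finite J \<Longrightarrow> finite (face D J y)"
  by (rotate_tac, induction J arbitrary: y rule: finite_induct) (auto simp: face_insert)

lemma sum_face_insert:
  assumes "finite D" "finite J" "i \<notin> J"
  shows "(\<Sum>x\<in>face D (insert i J) y. g x) = (\<Sum>a\<in>D. \<Sum>x\<in>face D J (y(i := a)). g x)"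
  unfolding face_insert[OF assms(3)]
  using assms by (intro sum.UNION_disjoint) (auto simp: finite_face, auto simp: face_def)

lemma sum_face_update:
  assumes "i \<notin> J"
  shows "(\<Sum>x\<in>face D J (y(i := a)). g x) = (\<Sum>x\<in>face D J y. g (x(i := a)))"
  using assms
  by (intro sum.reindex_bij_witness[where i = "\<lambda>x. x(i := a)" and j = "\<lambda>x. x(i := y i)"])
     (auto simp: face_def fun_upd_idem split: if_splits)

definition depends_only_on :: "'i set \<Rightarrow> (('i \<Rightarrow> 'a) \<Rightarrow> 'b) \<Rightarrow> bool" where
  "depends_only_on U f \<longleftrightarrow> (\<forall>x y. (\<forall>i\<in>U. x i = y i) \<longrightarrow> f x = f y)"

lemma depends_only_on_combine:
  assumes "depends_only_on U f" "depends_only_on U g"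
  shows "depends_only_on U (\<lambda>x. h (f x) (g x))"
  unfolding depends_only_on_def
proof (intro allI impI)
  fix x y :: "'a \<Rightarrow> 'b" assume "\<forall>i\<in>U. x i = y i"
  then have "f x = f y" "g x = g y" using assms by (simp_all add: depends_only_on_def)
  then show "h (f x) (g x) = h (f y) (g y)" by simp
qed

section \<open>Partition functions of sparse interactions\<close>

text \<open>The index \<open>j\<close> stands for an interaction term and \<open>S j\<close> for the coordinates on which it may depend.
The last assumption is what closes the induction: the left-hand side divided by \<open>cos (\<theta> / 2) ^ c\<close>
bounds the angle swept when one coordinate moves.\<close>

locale sparse_interaction =
  fixes D :: "'a set" and T :: "'j set" and S :: "'j \<Rightarrow> 'i set"
    and r c :: nat and B \<theta> :: real
  assumes finite_D: "finite D" and D_nonempty: "D \<noteq> {}"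
    and finite_T: "finite T"
    and finite_S: "j \<in> T \<Longrightarrow> finite (S j)" and card_S: "j \<in> T \<Longrightarrow> card (S j) \<le> c"
    and degree: "card {j \<in> T. i \<in> S j} \<le> r"
    and B_nonneg: "0 \<le> B" and angle_pos: "0 \<le> \<theta>" and angle_less: "3 * \<theta> < 2 * pi"
    and budget: "2 * real r * B \<le> \<theta> * cos (\<theta> / 2) ^ c"
begin

text \<open>The bound is required at all points, not only over the grid, so that faces with arbitrary base points can
be compared and admissibility is preserved by updates and by convex combinations.\<close>

definition admissible :: "('j \<Rightarrow> ('i \<Rightarrow> 'a) \<Rightarrow> complex) \<Rightarrow> bool" where
  "admissible \<phi> \<longleftrightarrow> (\<forall>j\<in>T. depends_only_on (S j) (\<phi> j) \<and> (\<forall>x. cmod (\<phi> j x) \<le> B))"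

definition boltzmann :: "('j \<Rightarrow> ('i \<Rightarrow> 'a) \<Rightarrow> complex) \<Rightarrow> ('i \<Rightarrow> 'a) \<Rightarrow> complex" where
  "boltzmann \<phi> x = exp (\<Sum>j\<in>T. \<phi> j x)"

definition Z :: "('j \<Rightarrow> ('i \<Rightarrow> 'a) \<Rightarrow> complex) \<Rightarrow> 'i set \<Rightarrow> ('i \<Rightarrow> 'a) \<Rightarrow> complex" where
  "Z \<phi> J y = (\<Sum>x\<in>face D J y. boltzmann \<phi> x)"

text \<open>The induction hypothesis. It quantifies over all admissible families at once, since the step for one
family uses the families interpolating between its restrictions.\<close>

definition tame :: "'i set \<Rightarrow> bool" where
  "tame J \<longleftrightarrow> (\<forall>\<phi>. admissible \<phi> \<longrightarrow>
     (\<forall>y. Z \<phi> J y \<noteq> 0) \<and>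
     (\<forall>y i a b. i \<notin> J \<longrightarrow>
        (\<exists>z. \<bar>Im z\<bar> \<le> \<theta> \<and> Z \<phi> J (y(i := a)) = Z \<phi> J (y(i := b)) * exp z)))"

lemma cos_half_angle: "0 < cos (\<theta> / 2)" "cos (\<theta> / 2) \<le> 1"
  using angle_pos angle_less pi_gt_zero by (auto intro!: cos_gt_zero_pi)

lemma Z_insert:
  assumes "finite J" "i \<notin> J"
  shows "Z \<phi> (insert i J) y = (\<Sum>a\<in>D. Z \<phi> J (y(i := a)))"
  unfolding Z_def by (rule sum_face_insert[OF finite_D assms])

lemma Z_insert_lower_bound:
  assumes "tame J" "finite J" "i \<notin> J" "admissible \<phi>"
  shows "cos (\<theta> / 2) * (\<Sum>a\<in>D. cmod (Z \<phi> J (y(i := a)))) \<le> cmod (Z \<phi> (insert i J) y)"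
  unfolding Z_insert[OF assms(2,3)]
  using assms by (intro sector_sum_lower_bound finite_D angle_less) (auto simp: tame_def)

text \<open>The free coordinates in \<open>U\<close> are fixed one at a time, each at the cost of one factor \<open>cos (\<theta> / 2)\<close> for
undoing the triangle inequality. Once none is left, \<open>\<psi>\<close> is constant on the face. Coordinates outside
\<open>U\<close> cost nothing, which is why the exponent is bounded independently of the size of \<open>J\<close>.\<close>

lemma local_observable_bound:
  assumes "finite J" "\<And>J'. J' \<subset> J \<Longrightarrow> tame J'" "admissible \<phi>"
    and "finite U" "depends_only_on U \<psi>" "\<And>x. cmod (\<psi> x) \<le> M"
  shows "cos (\<theta> / 2) ^ card (U \<inter> J) * cmod (\<Sum>x\<in>face D J y. \<psi> x * boltzmann \<phi> x)
           \<le> M * cmod (Z \<phi> J y)"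
  using assms(1,2)
proof (induction "card (U \<inter> J)" arbitrary: J y)
  case 0
  then have "U \<inter> J = {}" using assms(4) by simp
  have const: "\<psi> x = \<psi> y" if x: "x \<in> face D J y" for x
  proof -
    have "\<forall>i\<in>U. x i = y i" using x \<open>U \<inter> J = {}\<close> by (auto simp: face_def)
    then show ?thesis using assms(5) unfolding depends_only_on_def by blast
  qed
  then have "(\<Sum>x\<in>face D J y. \<psi> x * boltzmann \<phi> x) = \<psi> y * Z \<phi> J y"
    unfolding Z_def sum_distrib_left by (intro sum.cong) (auto simp: const)
  then show ?case using assms(6)[of y] by (simp add: norm_mult mult_right_mono \<open>U \<inter> J = {}\<close>)
next
  case (Suc n)
  from Suc.hyps(2) have "U \<inter> J \<noteq> {}" by auto
  then obtain i where i: "i \<in> U" "i \<in> J" by blast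
  define J' where "J' = J - {i}"
  have J: "J = insert i J'" "i \<notin> J'" "finite J'" "J' \<subset> J"
    using i Suc.prems(1) by (auto simp: J'_def)
  have "U \<inter> J = insert i (U \<inter> J')" using J i by auto
  then have n: "n = card (U \<inter> J')" using Suc.hyps(2) J(2,3) by simp
  let ?k = "cos (\<theta> / 2)" and ?E = "\<lambda>J y. \<Sum>x\<in>face D J y. \<psi> x * boltzmann \<phi> x"
  have M: "0 \<le> M" using assms(6)[of y] norm_ge_zero order_trans by blast
  have "?k ^ Suc n * cmod (?E J y) = ?k * (?k ^ n * cmod (\<Sum>a\<in>D. ?E J' (y(i := a))))"
    unfolding J(1) sum_face_insert[OF finite_D J(3,2)] by simp
  also have "\<dots> \<le> ?k * (?k ^ n * (\<Sum>a\<in>D. cmod (?E J' (y(i := a)))))"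
    using cos_half_angle by (intro mult_left_mono norm_sum) auto
  also have "\<dots> = ?k * (\<Sum>a\<in>D. ?k ^ n * cmod (?E J' (y(i := a))))"
    by (simp add: sum_distrib_left)
  also have "\<dots> \<le> ?k * (\<Sum>a\<in>D. M * cmod (Z \<phi> J' (y(i := a))))"
  proof (intro mult_left_mono sum_mono)
    fix a assume "a \<in> D"
    show "?k ^ n * cmod (?E J' (y(i := a))) \<le> M * cmod (Z \<phi> J' (y(i := a)))"
      unfolding n by (rule Suc.hyps(1)[OF n J(3)]) (use J(4) Suc.prems(2) in auto)
  qed (use cos_half_angle in auto)
  also have "\<dots> = M * (?k * (\<Sum>a\<in>D. cmod (Z \<phi> J' (y(i := a)))))"
    by (simp add: sum_distrib_left mult_ac)
  also have "\<dots> \<le> M * cmod (Z \<phi> J y)"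
    unfolding J(1) using Suc.prems(2)[OF J(4)] J(3,2) assms(3) M
    by (intro mult_left_mono Z_insert_lower_bound) auto
  finally show ?case using Suc.hyps(2) by simp
qed

lemma Z_nonzero:
  assumes "finite J" "\<And>J'. J' \<subset> J \<Longrightarrow> tame J'" "admissible \<phi>"
  shows "Z \<phi> J y \<noteq> 0"
proof (cases "J = {}")
  case True
  then show ?thesis by (simp add: Z_def boltzmann_def)
next
  case False
  then obtain i where i: "i \<in> J" by blast
  define J' where "J' = J - {i}"
  have J: "J = insert i J'" "i \<notin> J'" "finite J'" "J' \<subset> J"
    using i assms(1) by (auto simp: J'_def)
  have "0 < (\<Sum>a\<in>D. cmod (Z \<phi> J' (y(i := a))))"
    using finite_D D_nonempty assms(2)[OF J(4)] assms(3)
    by (intro sum_pos) (auto simp: tame_def)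
  then have "0 < cos (\<theta> / 2) * (\<Sum>a\<in>D. cmod (Z \<phi> J' (y(i := a))))"
    using cos_half_angle by simp
  then show ?thesis
    using Z_insert_lower_bound[OF assms(2)[OF J(4)] J(3,2) assms(3), of y] J(1) by auto
qed

text \<open>The two sums are the endpoints of a path of sums over one face, obtained by interpolating linearly between
the two restrictions of each \<open>\<phi>\<^sub>j\<close>. Only the terms with \<open>i \<in> S j\<close> move, each by at most \<open>2 B\<close>, and
\<open>local_observable_bound\<close> turns this into a bound on the logarithmic derivative.\<close>

lemma Z_update_ratio:
  assumes J: "finite J" "\<And>J'. J' \<subset> J \<Longrightarrow> tame J'" and adm: "admissible \<phi>" and i: "i \<notin> J"
  shows "\<exists>z. cmod z \<le> \<theta> \<and> Z \<phi> J (y(i := a)) = Z \<phi> J (y(i := b)) * exp z"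
proof -
  define \<phi>t where "\<phi>t t j x = (1 - of_real t) * \<phi> j (x(i := b)) + of_real t * \<phi> j (x(i := a))"
    for t :: real and j x
  define \<delta> where "\<delta> j x = \<phi> j (x(i := a)) - \<phi> j (x(i := b))" for j x
  define F' where "F' t = (\<Sum>x\<in>face D J y. (\<Sum>j\<in>T. \<delta> j x) * boltzmann (\<phi>t t) x)" for t
  let ?k = "cos (\<theta> / 2)"
  have dep_upd: "depends_only_on (S j) (\<lambda>x. \<phi> j (x(i := d)))" if "j \<in> T" for j d
    using adm that by (fastforce simp: admissible_def depends_only_on_def)
  have adm_t: "admissible (\<phi>t t)" if t: "t \<in> {0..1}" for t
    unfolding admissible_def
  proof (intro ballI conjI allI)
    fix j x assume j: "j \<in> T"
    show "depends_only_on (S j) (\<phi>t t j)"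
      unfolding \<phi>t_def by (rule depends_only_on_combine[OF dep_upd[OF j, of b] dep_upd[OF j, of a]])
    have "cmod (\<phi>t t j x) \<le> (1 - t) * cmod (\<phi> j (x(i := b))) + t * cmod (\<phi> j (x(i := a)))"
    proof -
      have "1 - complex_of_real t = complex_of_real (1 - t)" by simp
      then have "cmod (1 - complex_of_real t) = 1 - t" using t by (simp only: norm_of_real) simp
      then show ?thesis
        unfolding \<phi>t_def using t by (intro norm_triangle_le) (simp add: norm_mult)
    qed
    also have "\<dots> \<le> (1 - t) * B + t * B"
      using t adm j unfolding admissible_def by (intro add_mono mult_left_mono) auto
    finally show "cmod (\<phi>t t j x) \<le> B" by (simp add: algebra_simps)
  qed
  have exponent: "(\<Sum>j\<in>T. \<phi>t t j x) = (\<Sum>j\<in>T. \<phi> j (x(i := b))) + of_real t * (\<Sum>j\<in>T. \<delta> j x)" for t x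
  proof -
    have "\<phi>t t j x = \<phi> j (x(i := b)) + of_real t * \<delta> j x" for j
      by (simp add: \<phi>t_def \<delta>_def algebra_simps)
    then show ?thesis by (simp add: sum.distrib sum_distrib_left)
  qed
  have exp_deriv: "((\<lambda>t. exp (p + of_real t * q)) has_vector_derivative q * exp (p + of_real t * q))
      (at t within X)" for p q :: complex and t :: real and X
    by (rule has_vector_derivative_real_field[where f = "\<lambda>z. exp (p + z * q)"])
       (auto intro!: derivative_eq_intros)
  have deriv: "((\<lambda>t. Z (\<phi>t t) J y) has_vector_derivative F' t) (at t within {0..1})" for t
    unfolding Z_def F'_def boltzmann_def exponent
    by (intro has_vector_derivative_sum exp_deriv)
  have cont: "continuous_on {0..1} F'"
    unfolding F'_def boltzmann_def exponent by (intro continuous_intros)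
  have bound: "cmod (F' t) \<le> \<theta> * cmod (Z (\<phi>t t) J y)" if t: "t \<in> {0..1}" for t
  proof -
    define E where "E j = (\<Sum>x\<in>face D J y. \<delta> j x * boltzmann (\<phi>t t) x)" for j
    have "F' t = (\<Sum>j\<in>T. E j)"
      unfolding F'_def E_def sum_distrib_right by (rule sum.swap)
    also have "\<dots> = (\<Sum>j\<in>{j \<in> T. i \<in> S j}. E j)"
    proof (rule sum.mono_neutral_right)
      show "\<forall>j\<in>T - {j \<in> T. i \<in> S j}. E j = 0"
      proof
        fix j assume j: "j \<in> T - {j \<in> T. i \<in> S j}"
        have "\<delta> j x = 0" for x
        proof -
          have "depends_only_on (S j) (\<phi> j)" "\<forall>l\<in>S j. (x(i := a)) l = (x(i := b)) l"
            using j adm by (auto simp: admissible_def)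
          then show ?thesis unfolding depends_only_on_def \<delta>_def by simp
        qed
        then show "E j = 0" by (simp add: E_def)
      qed
    qed (use finite_T in auto)
    finally have F': "F' t = (\<Sum>j\<in>{j \<in> T. i \<in> S j}. E j)" .
    have E: "?k ^ c * cmod (E j) \<le> 2 * B * cmod (Z (\<phi>t t) J y)" if j: "j \<in> T" for j
    proof -
      have "card (S j \<inter> J) \<le> c"
        using card_S[OF j] card_mono[OF finite_S[OF j], of "S j \<inter> J"] by simp
      then have "?k ^ c \<le> ?k ^ card (S j \<inter> J)"
        using cos_half_angle by (intro power_decreasing) auto
      then have "?k ^ c * cmod (E j) \<le> ?k ^ card (S j \<inter> J) * cmod (E j)"
        by (rule mult_right_mono) simp
      also have "\<dots> \<le> 2 * B * cmod (Z (\<phi>t t) J y)"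
        unfolding E_def
      proof (rule local_observable_bound[OF J adm_t[OF t] finite_S[OF j]])
        show "depends_only_on (S j) (\<delta> j)"
          unfolding \<delta>_def by (rule depends_only_on_combine[OF dep_upd[OF j] dep_upd[OF j]])
        show "cmod (\<delta> j x) \<le> 2 * B" for x
        proof -
          have "cmod (\<delta> j x) \<le> cmod (\<phi> j (x(i := a))) + cmod (\<phi> j (x(i := b)))"
            unfolding \<delta>_def by (rule norm_triangle_ineq4)
          also have "\<dots> \<le> B + B"
            using adm j unfolding admissible_def by (intro add_mono) auto
          finally show ?thesis by simp
        qed
      qed
      finally show ?thesis .
    qed
    have "?k ^ c * cmod (F' t) \<le> (\<Sum>j\<in>{j \<in> T. i \<in> S j}. ?k ^ c * cmod (E j))"
      unfolding F' sum_distrib_left[symmetric]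
      using cos_half_angle by (intro mult_left_mono norm_sum) auto
    also have "\<dots> \<le> real (card {j \<in> T. i \<in> S j}) * (2 * B * cmod (Z (\<phi>t t) J y))"
      using E by (intro sum_bounded_above) auto
    also have "\<dots> \<le> real r * (2 * B * cmod (Z (\<phi>t t) J y))"
      using degree[of i] B_nonneg by (intro mult_right_mono) auto
    also have "\<dots> = (2 * real r * B) * cmod (Z (\<phi>t t) J y)" by simp
    also have "\<dots> \<le> (\<theta> * ?k ^ c) * cmod (Z (\<phi>t t) J y)"
      by (rule mult_right_mono[OF budget]) simp
    finally have "?k ^ c * cmod (F' t) \<le> ?k ^ c * (\<theta> * cmod (Z (\<phi>t t) J y))"
      by (simp add: mult_ac)
    then show ?thesis using cos_half_angle by simp
  qed
  have "\<exists>z. cmod z \<le> \<theta> \<and> Z (\<phi>t 1) J y = Z (\<phi>t 0) J y * exp z"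
    by (rule endpoint_ratio_of_log_derivative_bound[OF deriv cont _ bound])
       (use Z_nonzero[OF J adm_t] in auto)
  moreover have "Z (\<phi>t 1) J y = Z \<phi> J (y(i := a))" "Z (\<phi>t 0) J y = Z \<phi> J (y(i := b))"
    unfolding Z_def sum_face_update[OF i] by (simp_all add: boltzmann_def \<phi>t_def)
  ultimately show ?thesis by (simp only:)
qed

lemma all_faces_tame: "finite J \<Longrightarrow> tame J"
proof (induction J rule: finite_psubset_induct)
  case (psubset J)
  show ?case unfolding tame_def
  proof (intro allI impI conjI)
    fix \<phi> y assume adm: "admissible \<phi>"
    show "Z \<phi> J y \<noteq> 0" by (rule Z_nonzero[OF psubset adm])
    fix i a b assume "i \<notin> J"
    then obtain z where "cmod z \<le> \<theta>" "Z \<phi> J (y(i := a)) = Z \<phi> J (y(i := b)) * exp z"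
      using Z_update_ratio[OF psubset adm] by blast
    then show "\<exists>z. \<bar>Im z\<bar> \<le> \<theta> \<and> Z \<phi> J (y(i := a)) = Z \<phi> J (y(i := b)) * exp z"
      using abs_Im_le_cmod[of z] by (intro exI[of _ z]) linarith
  qed
qed

end

section \<open>Solutions as an average of characters\<close>

text \<open>In the power series of the logarithm, the terms from the second one on are dominated by half a geometric
series.\<close>

lemma cmod_Ln_1_plus_le:
  fixes z :: complex
  assumes "cmod z < 1"
  shows "cmod (Ln (1 + z)) \<le> cmod z + cmod z ^ 2 / (2 * (1 - cmod z))"
proof -
  let ?a = "\<lambda>n. - ((- z) ^ n) / of_nat n"
  have tail: "(\<lambda>n. ?a (n + 2)) sums (Ln (1 + z) - (\<Sum>n<2. ?a n))"
    by (rule sums_split_initial_segment[OF Ln_series'[OF assms]])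
  have first: "(\<Sum>n<2. ?a n) = z" by (simp add: numeral_2_eq_2)
  have geo: "(\<lambda>n. cmod z ^ 2 / 2 * cmod z ^ n) sums (cmod z ^ 2 / 2 * (1 / (1 - cmod z)))"
    using assms by (intro sums_mult geometric_sums) simp
  have "cmod (?a (n + 2)) \<le> cmod z ^ 2 / 2 * cmod z ^ n" for n
  proof -
    have "cmod (?a (n + 2)) = cmod z ^ (n + 2) / real (n + 2)"
      by (simp add: norm_divide norm_power del: of_nat_add power_Suc flip: of_nat_Suc)
    also have "\<dots> \<le> cmod z ^ (n + 2) / 2" by (intro divide_left_mono) auto
    also have "\<dots> = cmod z ^ 2 / 2 * cmod z ^ n" by (simp add: power_add power2_eq_square)
    finally show ?thesis .
  qed
  then have "cmod (\<Sum>n. ?a (n + 2)) \<le> (\<Sum>n. cmod z ^ 2 / 2 * cmod z ^ n)"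
    by (rule norm_suminf_le[OF _ sums_summable[OF geo]])
  also have "\<dots> = cmod z ^ 2 / 2 * (1 / (1 - cmod z))" by (rule sums_unique[OF geo, symmetric])
  finally have "cmod (\<Sum>n. ?a (n + 2)) \<le> cmod z ^ 2 / 2 * (1 / (1 - cmod z))" .
  then have "cmod (Ln (1 + z) - z) \<le> cmod z ^ 2 / (2 * (1 - cmod z))"
    using tail first by (simp add: sums_iff)
  then show ?thesis using norm_triangle_sub[of "Ln (1 + z)" z] by linarith
qed

definition root_char :: "nat \<Rightarrow> int \<Rightarrow> complex" where
  "root_char N k = cis (2 * pi * of_int k / of_nat N)"

lemma cmod_root_char [simp]: "cmod (root_char N k) = 1"
  by (simp add: root_char_def)

lemma root_char_0 [simp]: "root_char N 0 = 1"
  by (simp add: root_char_def)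

lemma root_char_add: "root_char N (k + l) = root_char N k * root_char N l"
  by (simp add: root_char_def cis_mult ring_distribs add_divide_distrib)

lemma root_char_sum: "root_char N (\<Sum>i\<in>I. f i) = (\<Prod>i\<in>I. root_char N (f i))"
  by (induction I rule: infinite_finite_induct) (simp_all add: root_char_add)

lemma root_char_mult_nat: "root_char N (k * int n) = root_char N k ^ n"
  by (induction n) (simp_all add: root_char_add algebra_simps)

lemma root_char_eq_1:
  assumes "N > 0" "\<bar>b\<bar> < int N" "root_char N b = 1"
  shows "b = 0"
proof -
  have "exp (\<i> * of_real (2 * pi * of_int b / of_nat N)) = 1"
    using assms(3) by (simp add: root_char_def cis_conv_exp)
  then obtain k :: int where "2 * pi * of_int b / of_nat N = of_int (2 * k) * pi"
    unfolding exp_eq_1 by auto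
  then have "of_int b = (of_int (k * int N) :: real)"
    using assms(1) by (simp add: field_simps)
  then have b: "b = k * int N" by (simp only: of_int_eq_iff)
  then have "\<bar>k\<bar> * int N < 1 * int N" using assms(2) by (simp add: abs_mult)
  then have "\<bar>k\<bar> < 1" by (rule mult_right_less_imp_less) simp
  then show "b = 0" using b by simp
qed

text \<open>The average over \<open>\<int>/N\<close> detects the vanishing of the integer \<open>b\<close> itself, and not only of its residue,
because \<open>b\<close> is smaller than \<open>N\<close> in absolute value.\<close>

lemma sum_root_char:
  assumes "N > 0" "\<bar>b\<bar> < int N"
  shows "(\<Sum>k<N. root_char N (b * int k)) = (if b = 0 then of_nat N else 0)"
proof (cases "b = 0")
  case False
  have "root_char N b \<noteq> 1" using root_char_eq_1[OF assms] False by blast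
  moreover have "root_char N b ^ N = 1"
  proof -
    have "real N * (2 * pi * of_int b / real N) = 2 * pi * of_int b" using assms(1) by simp
    then have "root_char N b ^ N = cis (2 * pi * of_int b)"
      by (simp only: root_char_def Complex.DeMoivre)
    then show ?thesis by simp
  qed
  ultimately show ?thesis
    using False by (simp add: root_char_mult_nat geometric_sum)
qed simp

lemma sum_PiE_root_char:
  assumes "finite I" "N > 0" "\<And>i. i \<in> I \<Longrightarrow> \<bar>b i\<bar> < int N"
  shows "(\<Sum>x\<in>PiE I (\<lambda>_. {..<N}). root_char N (\<Sum>i\<in>I. b i * int (x i)))
         = (if \<forall>i\<in>I. b i = 0 then of_nat N ^ card I else 0)"
proof -
  have "(\<Sum>x\<in>PiE I (\<lambda>_. {..<N}). root_char N (\<Sum>i\<in>I. b i * int (x i)))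
      = (\<Prod>i\<in>I. \<Sum>k<N. root_char N (b i * int k))"
    using assms(1) by (simp add: root_char_sum prod_sum_PiE)
  also have "\<dots> = (\<Prod>i\<in>I. if b i = 0 then of_nat N else 0)"
    using assms by (intro prod.cong refl sum_root_char) auto
  also have "\<dots> = (if \<forall>i\<in>I. b i = 0 then of_nat N ^ card I else 0)"
    using assms(1) by auto
  finally show ?thesis .
qed

lemma weight_solutions_eq_sum_subsets:
  assumes A: "A \<in> carrier_mat m n" and w: "w \<in> carrier_vec n"
  shows "weight w (solutions A) =
    (\<Sum>V\<in>{V \<in> Pow {..<n}. \<forall>i<m. (\<Sum>j\<in>V. A $$ (i, j)) = 0}. \<Prod>j\<in>V. vec_index w j)"
proof -
  define supp where "supp x = {j. j < n \<and> vec_index x j = 1}" for x :: "nat Matrix.vec"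
  define ind where "ind V = Matrix.vec n (\<lambda>j. if j \<in> V then 1 else 0 :: nat)" for V
  have dims: "dim_row A = m" "dim_col A = n" "dim_vec w = n" using A w by auto
  have row: "(\<Sum>j<n. A $$ (i, j) * int (vec_index x j)) = (\<Sum>j\<in>supp x. A $$ (i, j))"
    if x: "x \<in> cube n" for x i
  proof -
    have "supp x \<subseteq> {..<n}" by (auto simp: supp_def)
    moreover have "A $$ (i, j) * int (vec_index x j) = (if j \<in> supp x then A $$ (i, j) else 0)"
      if "j < n" for j using x that by (auto simp: cube_def supp_def)
    ultimately show ?thesis by (simp add: sum.If_cases Int_absorb1)
  qed
  have pr: "(\<Prod>j<n. vec_index w j ^ vec_index x j) = (\<Prod>j\<in>supp x. vec_index w j)"
    if x: "x \<in> cube n" for x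
  proof -
    have "supp x \<subseteq> {..<n}" by (auto simp: supp_def)
    moreover have "vec_index w j ^ vec_index x j = (if j \<in> supp x then vec_index w j else 1)"
      if "j < n" for j using x that by (auto simp: cube_def supp_def)
    ultimately show ?thesis by (simp add: prod.If_cases Int_absorb1)
  qed
  have ind_cube: "ind V \<in> cube n" for V by (auto simp: ind_def cube_def)
  have supp_ind: "supp (ind V) = V" if "V \<subseteq> {..<n}" for V
    using that by (auto simp: supp_def ind_def split: if_splits)
  have ind_supp: "ind (supp x) = x" if "x \<in> cube n" for x
    using that by (auto simp: supp_def ind_def cube_def intro!: eq_vecI)
  show ?thesis
    unfolding weight_def dims
  proof (rule sum.reindex_bij_witness[where i = ind and j = supp])
    fix x assume "x \<in> solutions A"
    then have x: "x \<in> cube n" "\<forall>i<m. (\<Sum>j<n. A $$ (i, j) * int (vec_index x j)) = 0"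
      unfolding solutions_def dims by auto
    show "ind (supp x) = x" by (rule ind_supp[OF x(1)])
    show "supp x \<in> {V \<in> Pow {..<n}. \<forall>i<m. (\<Sum>j\<in>V. A $$ (i, j)) = 0}"
      using x row[OF x(1)] by (auto simp: supp_def)
    show "(\<Prod>j\<in>supp x. vec_index w j) = (\<Prod>j<n. vec_index w j ^ vec_index x j)"
      using pr[OF x(1)] by simp
  next
    fix V assume V: "V \<in> {V \<in> Pow {..<n}. \<forall>i<m. (\<Sum>j\<in>V. A $$ (i, j)) = 0}"
    show "supp (ind V) = V" using V supp_ind by blast
    then show "ind V \<in> solutions A"
      unfolding solutions_def dims using V ind_cube[of V] row[OF ind_cube] by simp
  qed
qed

text \<open>Expanding the product over the columns gives one term for each set \<open>V\<close> of columns. Averaging over \<open>x\<close>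
annihilates it unless all row sums of \<open>A\<close> over \<open>V\<close> vanish, that is, unless the indicator vector of \<open>V\<close>
solves the system.\<close>

lemma weight_solutions_as_average:
  assumes A: "A \<in> carrier_mat m n" and w: "w \<in> carrier_vec n"
    and N: "\<And>i. i < m \<Longrightarrow> (\<Sum>j<n. \<bar>A $$ (i, j)\<bar>) < int N" and "N > 0"
  shows "(\<Sum>x\<in>PiE {..<m} (\<lambda>_. {..<N}).
            \<Prod>j<n. 1 + vec_index w j * root_char N (\<Sum>i<m. A $$ (i, j) * int (x i)))
         = of_nat N ^ m * weight w (solutions A)"
proof -
  let ?X = "PiE {..<m} (\<lambda>_. {..<N})"
  let ?b = "\<lambda>V i. \<Sum>j\<in>V. A $$ (i, j)"
  have "(\<Prod>j<n. 1 + vec_index w j * root_char N (\<Sum>i<m. A $$ (i, j) * int (x i)))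
      = (\<Sum>V\<in>Pow {..<n}. (\<Prod>j\<in>V. vec_index w j) * root_char N (\<Sum>i<m. ?b V i * int (x i)))" for x
  proof -
    have "(\<Prod>j<n. 1 + vec_index w j * root_char N (\<Sum>i<m. A $$ (i, j) * int (x i)))
      = (\<Prod>j<n. vec_index w j * root_char N (\<Sum>i<m. A $$ (i, j) * int (x i)) + 1)"
      by (simp add: add.commute)
    also have "\<dots> = (\<Sum>V\<in>Pow {..<n}. \<Prod>j\<in>V. vec_index w j * root_char N (\<Sum>i<m. A $$ (i, j) * int (x i)))"
      by (simp add: prod_add)
    also have "\<dots> = (\<Sum>V\<in>Pow {..<n}. (\<Prod>j\<in>V. vec_index w j) * root_char N (\<Sum>i<m. ?b V i * int (x i)))"
    proof (rule sum.cong[OF refl])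
      fix V
      have "(\<Prod>j\<in>V. root_char N (\<Sum>i<m. A $$ (i, j) * int (x i)))
          = root_char N (\<Sum>j\<in>V. \<Sum>i<m. A $$ (i, j) * int (x i))"
        by (simp only: root_char_sum)
      also have "(\<Sum>j\<in>V. \<Sum>i<m. A $$ (i, j) * int (x i)) = (\<Sum>i<m. ?b V i * int (x i))"
        unfolding sum_distrib_right by (rule sum.swap)
      finally show "(\<Prod>j\<in>V. vec_index w j * root_char N (\<Sum>i<m. A $$ (i, j) * int (x i)))
          = (\<Prod>j\<in>V. vec_index w j) * root_char N (\<Sum>i<m. ?b V i * int (x i))"
        by (simp add: prod.distrib)
    qed
    finally show ?thesis .
  qed
  then have "(\<Sum>x\<in>?X. \<Prod>j<n. 1 + vec_index w j * root_char N (\<Sum>i<m. A $$ (i, j) * int (x i)))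
      = (\<Sum>V\<in>Pow {..<n}. (\<Prod>j\<in>V. vec_index w j) * (\<Sum>x\<in>?X. root_char N (\<Sum>i<m. ?b V i * int (x i))))"
    unfolding sum_distrib_left by (simp only:) (rule sum.swap)
  also have "\<dots> = (\<Sum>V\<in>Pow {..<n}. (\<Prod>j\<in>V. vec_index w j) * (if \<forall>i\<in>{..<m}. ?b V i = 0 then of_nat N ^ card {..<m} else 0))"
  proof (intro sum.cong refl arg_cong2[where f = "(*)"] sum_PiE_root_char \<open>N > 0\<close>)
    fix V i assume V: "V \<in> Pow {..<n}" and i: "i \<in> {..<m}"
    have "\<bar>?b V i\<bar> \<le> (\<Sum>j\<in>V. \<bar>A $$ (i, j)\<bar>)" by (rule sum_abs)
    also have "\<dots> \<le> (\<Sum>j<n. \<bar>A $$ (i, j)\<bar>)" using V by (intro sum_mono2) auto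
    finally show "\<bar>?b V i\<bar> < int N" using N[of i] i by simp
  qed simp
  also have "\<dots> = (\<Sum>V\<in>Pow {..<n}. if \<forall>i<m. ?b V i = 0 then of_nat N ^ m * (\<Prod>j\<in>V. vec_index w j) else 0)"
    by (intro sum.cong) auto
  also have "\<dots> = of_nat N ^ m * weight w (solutions A)"
    unfolding weight_solutions_eq_sum_subsets[OF A w] sum_distrib_left
    by (subst sum.inter_filter) auto
  finally show ?thesis .
qed

section \<open>The constant\<close>

text \<open>The argument is \<open>\<theta> / 2\<close> for \<open>\<theta> = 3 / (2 \<surd>c)\<close>. From \<open>cos t \<ge> 1 - t\<^sup>2 / 2\<close> the cosine is at least
\<open>1 - 9 / (32 c)\<close>, and Bernoulli's inequality removes the dependence on \<open>c\<close>.\<close>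

lemma cos_power_lower_bound:
  assumes "c \<ge> (1::nat)"
  shows "23 / 32 \<le> cos (3 / (4 * sqrt (real c))) ^ c"
proof -
  let ?h = "3 / (4 * sqrt (real c))"
  have h2: "?h\<^sup>2 = 9 / (16 * real c)" by (simp add: power_divide power_mult_distrib)
  have "sin (?h / 2) ^ 2 \<le> (?h / 2)\<^sup>2"
    using abs_sin_x_le_abs_x[of "?h / 2"] by (metis abs_le_square_iff)
  moreover have "cos ?h = 1 - 2 * sin (?h / 2) ^ 2"
    using cos_double_sin[of "?h / 2"] by simp
  ultimately have "1 + (- 9 / (32 * real c)) \<le> cos ?h"
    using h2 by (simp add: power_divide)
  moreover have x: "- 1 \<le> - 9 / (32 * real c)" "1 + real c * (- 9 / (32 * real c)) = 23 / 32"
    using assms by (auto simp: field_simps)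
  ultimately have "(1 + (- 9 / (32 * real c))) ^ c \<le> cos ?h ^ c"
    by (intro power_mono) auto
  with Bernoulli_inequality[OF x(1), of c] x(2) show ?thesis by linarith
qed

theorem theorem1p2:
  shows "(\<exists>\<alpha>>0. nonvanishing_constant \<alpha>) \<and> nonvanishing_constant 0.46"
proof -
  have "nonvanishing_constant 0.46"
    unfolding nonvanishing_constant_def
  proof (intro allI impI)
    fix m n :: nat and A :: "int mat" and r c :: nat and w :: "complex Matrix.vec"
    assume A: "A \<in> carrier_mat m n" and r: "2 \<le> r" and c: "1 \<le> c"
      and rows: "\<forall>i<m. card {j. j < n \<and> A $$ (i, j) \<noteq> 0} \<le> r"
      and cols: "\<forall>j<n. card {i. i < m \<and> A $$ (i, j) \<noteq> 0} \<le> c"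
      and w: "w \<in> carrier_vec n"
      and small: "\<forall>j<n. cmod (vec_index w j) \<le> 0.46 / (real r * sqrt (real c))"
    define N where "N = nat (Max (insert 0 ((\<lambda>i. \<Sum>j<n. \<bar>A $$ (i, j)\<bar>) ` {..<m})) + 1)"
    have N: "(\<Sum>j<n. \<bar>A $$ (i, j)\<bar>) < int N" if "i < m" for i
    proof -
      have "(\<Sum>j<n. \<bar>A $$ (i, j)\<bar>) \<le> Max (insert 0 ((\<lambda>i. \<Sum>j<n. \<bar>A $$ (i, j)\<bar>) ` {..<m}))"
        using that by (intro Max_ge) auto
      then show ?thesis by (simp add: N_def)
    qed
    have "0 \<le> Max (insert 0 ((\<lambda>i. \<Sum>j<n. \<bar>A $$ (i, j)\<bar>) ` {..<m}))"
      by (intro Max_ge) auto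
    then have N0: "N > 0" by (simp add: N_def)

    \<comment> \<open>The multiple \<open>3 / 2\<close> nearly maximises \<open>t (1 - t\<^sup>2 / 8)\<close>, to which the budget condition reduces,
      and \<open>B\<close> is the bound on the weights times the loss \<open>23 / 20\<close> from taking logarithms.\<close>
    define \<theta> where "\<theta> = 3 / (2 * sqrt (real c))"
    define B where "B = (23 / 20 * 0.46) / (real r * sqrt (real c))"
    define S where "S j = {i. i < m \<and> A $$ (i, j) \<noteq> 0}" for j
    define g where "g j x = vec_index w j * root_char N (\<Sum>i<m. A $$ (i, j) * int (x i))"
      for j and x :: "nat \<Rightarrow> nat"
    define \<phi> where "\<phi> j x = Ln (1 + g j x)" for j x
    have sqrt_c: "1 \<le> sqrt (real c)" using c by simp
    have rc: "2 \<le> real r * sqrt (real c)"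
      using mult_mono[of 2 "real r" 1 "sqrt (real c)"] r sqrt_c by simp
    interpret sparse_interaction "{..<N}" "{..<n}" S r c B \<theta>
    proof
      show "card {j \<in> {..<n}. i \<in> S j} \<le> r" for i
      proof (cases "i < m")
        case True
        then have "{j \<in> {..<n}. i \<in> S j} = {j. j < n \<and> A $$ (i, j) \<noteq> 0}" by (auto simp: S_def)
        then show ?thesis using rows True by simp
      qed (simp add: S_def)
      show "0 \<le> B" using rc by (simp add: B_def)
      show "0 \<le> \<theta>" by (simp add: \<theta>_def)
      have "\<theta> \<le> 3 / 2" using sqrt_c by (simp add: \<theta>_def divide_le_eq)
      then show "3 * \<theta> < 2 * pi" using pi_gt3 by simp
      have "2 * real r * B = 1.058 / sqrt (real c)" using r by (simp add: B_def)
      also have "\<dots> \<le> (69 / 64) / sqrt (real c)"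
        using sqrt_c by (intro divide_right_mono) auto
      also have "\<dots> = \<theta> * (23 / 32)" by (simp add: \<theta>_def)
      also have "\<dots> \<le> \<theta> * cos (\<theta> / 2) ^ c"
        using cos_power_lower_bound[OF c] by (intro mult_left_mono) (auto simp: \<theta>_def)
      finally show "2 * real r * B \<le> \<theta> * cos (\<theta> / 2) ^ c" .
    qed (use cols N0 in \<open>auto simp: S_def lessThan_empty_iff\<close>)

    have g_le: "cmod (g j x) \<le> 0.46 / (real r * sqrt (real c))" if "j < n" for j x
      using small that by (simp add: g_def norm_mult)
    have g_less: "cmod (g j x) \<le> 0.23" if "j < n" for j x
    proof -
      have "0.46 / (real r * sqrt (real c)) \<le> 0.46 / 2" using rc by (intro divide_left_mono) auto
      from order_trans[OF g_le[OF that] this] show ?thesis by simp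
    qed
    have "admissible \<phi>"
      unfolding admissible_def
    proof (intro ballI conjI allI)
      fix j x assume "j \<in> {..<n}"
      then have j: "j < n" by simp
      show "depends_only_on (S j) (\<phi> j)"
        unfolding depends_only_on_def
      proof (intro allI impI)
        fix x y :: "nat \<Rightarrow> nat" assume xy: "\<forall>i\<in>S j. x i = y i"
        have "(\<Sum>i<m. A $$ (i, j) * int (x i)) = (\<Sum>i<m. A $$ (i, j) * int (y i))"
          using xy by (intro sum.cong) (auto simp: S_def)
        then show "\<phi> j x = \<phi> j y" by (simp add: \<phi>_def g_def)
      qed
      let ?\<rho> = "cmod (g j x)"
      have "?\<rho> ^ 2 / (2 * (1 - ?\<rho>)) = ?\<rho> * (?\<rho> / (2 * (1 - ?\<rho>)))"
        by (simp add: power2_eq_square)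
      also have "\<dots> \<le> ?\<rho> * (3 / 20)"
        using g_less[OF j, of x] by (intro mult_left_mono) (auto simp: divide_le_eq)
      finally have "?\<rho> ^ 2 / (2 * (1 - ?\<rho>)) \<le> ?\<rho> * (3 / 20)" .
      moreover have "cmod (\<phi> j x) \<le> ?\<rho> + ?\<rho> ^ 2 / (2 * (1 - ?\<rho>))"
        unfolding \<phi>_def using g_less[OF j, of x] by (intro cmod_Ln_1_plus_le) simp
      ultimately have "cmod (\<phi> j x) \<le> 23 / 20 * ?\<rho>" by linarith
      also have "\<dots> \<le> 23 / 20 * (0.46 / (real r * sqrt (real c)))"
        using g_le[OF j, of x] by (intro mult_left_mono) auto
      finally show "cmod (\<phi> j x) \<le> B" by (simp add: B_def)
    qed
    then have "Z \<phi> {..<m} (\<lambda>_. undefined) \<noteq> 0"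
      using all_faces_tame[of "{..<m}"] by (simp add: tame_def)
    moreover have "boltzmann \<phi> x = (\<Prod>j<n. 1 + g j x)" for x
    proof -
      have "1 + g j x \<noteq> 0" if "j < n" for j
      proof
        assume "1 + g j x = 0"
        then have "g j x = - 1" by (simp add: add_eq_0_iff)
        then show False using g_less[OF that, of x] by simp
      qed
      then show ?thesis by (simp add: boltzmann_def \<phi>_def exp_sum)
    qed
    \<comment> \<open>The base point \<open>undefined\<close> makes the full face the extensional function space of the average.\<close>
    moreover have "face {..<N} {..<m} (\<lambda>_. undefined) = PiE {..<m} (\<lambda>_. {..<N})"
      by (auto simp: face_def PiE_def extensional_def)
    ultimately have "(\<Sum>x\<in>PiE {..<m} (\<lambda>_. {..<N}). \<Prod>j<n. 1 + g j x) \<noteq> 0"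
      by (simp add: Z_def)
    moreover have "(\<Sum>x\<in>PiE {..<m} (\<lambda>_. {..<N}). \<Prod>j<n. 1 + g j x) = of_nat N ^ m * weight w (solutions A)"
      unfolding g_def by (rule weight_solutions_as_average[OF A w N N0])
    ultimately show "weight w (solutions A) \<noteq> 0" by simp
  qed
  then show ?thesis by (intro conjI exI[of _ "0.46"]) auto
qed

end
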